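(* Let $s$ be a positive integer, let $F$ be a continuous distribution function on $\mathbb{R}$, and let $$\alpha_1=1,\qquad \alpha_i=\prod_{j=2}^{i}\frac{1+(j-2)^s}{(j-1)^s}\quad (i=2,3,\ldots).$$ Let $X_1,X_2,\ldots$ be independent real random variables such that $X_i$ has distribution function $F(x)^{\alpha_i}$ for each $i\ge 1$. Let $L_1,L_2,\ldots$ be the record times of the sequence $X_1,X_2,\ldots$. Then for every integer $k\ge 1$ and every integer $n\ge k$, $$P(L_k=n)=\frac{S_s(n-1,k-1)}{\prod_{i=1}^{n}\bigl(1+(i-1)^s\bigr)},$$ where $S_s(n,k)$ denotes the Stirling number of the first kind with level $s$.
   Context: For a positive integer $s$, the Stirling numbers of the first kind with level $s$, written $S_s(n,k)$, are defined for integers $0\le k\le n$ by the polynomial identity $$\prod_{i=0}^{n-1}(x+i^s)=\sum_{k=0}^{n}S_s(n,k)\,x^k,\qquad n\ge 0,$$ where the empty product is $1$ (so $S_s(0,0)=1$ and $S_s(n,0)=0$ for $n\ge 1$). The record times of a sequence of random variables $X_1,X_2,\ldots$ are defined by $L_1=1$ and $L_{m+1}=\min\{j: X_j>X_{L_m}\}$ for $m\ge 1$, with the convention that $L_{m+1}=\infty$ if $L_m=\infty$ or if no such $j$ exists. Thus $L_k$ is the index of the $k$-th (upper) record, where $X_j$ is a record if $X_j>X_i$ for all $i<j$, and $X_1$ is a record by convention. *)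

theory Defs
  imports "HOL-Probability.Probability" "HOL-Computational_Algebra.Polynomial"
begin

definition stirling_level :: "nat \<Rightarrow> nat \<Rightarrow> nat \<Rightarrow> nat" where
  "stirling_level s n k = coeff (\<Prod>i<n. [:i ^ s, 1:]) k"

lemma degree_stirling_level_prod: "degree (\<Prod>i<n. [:i ^ s, 1::nat:]) \<le> n"
proof -
  have "degree (\<Prod>i<n. [:i ^ s, 1::nat:]) \<le> (\<Sum>i<n. degree [:i ^ s, 1::nat:])"
    using degree_prod_sum_le[of "{..<n}" "\<lambda>i. [:i ^ s, 1::nat:]"] by (simp add: o_def)
  then show ?thesis
    by simp
qed

lemma stirling_level_identity:
  fixes x :: "'a::comm_semiring_1"
  shows "(\<Prod>i<n. x + of_nat i ^ s) = (\<Sum>k\<le>n. of_nat (stirling_level s n k) * x ^ k)"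
proof (induction n)
  case 0
  show ?case by (simp add: stirling_level_def)
next
  case (Suc n)
  let ?p = "\<lambda>n. (\<Prod>i<n. [:i ^ s, 1::nat:])"
  have rec: "?p (Suc n) = smult (n ^ s) (?p n) + pCons 0 (?p n)"
    by (simp add: mult.commute del: One_nat_def)
  have c: "stirling_level s (Suc n) k = n ^ s * stirling_level s n k +
      (case k of 0 \<Rightarrow> 0 | Suc k' \<Rightarrow> stirling_level s n k')" for k
    unfolding stirling_level_def rec by (simp add: coeff_pCons split: nat.split)
  have top: "stirling_level s n (Suc n) = 0"
    unfolding stirling_level_def
    by (rule coeff_eq_0) (use degree_stirling_level_prod[of s n] in linarith)
  have "(\<Sum>k\<le>Suc n. of_nat (stirling_level s (Suc n) k) * x ^ k) =
      of_nat n ^ s * (\<Sum>k\<le>Suc n. of_nat (stirling_level s n k) * x ^ k) +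
      (\<Sum>k\<le>Suc n. of_nat (case k of 0 \<Rightarrow> 0 | Suc k' \<Rightarrow> stirling_level s n k') * x ^ k)"
    by (simp only: c of_nat_add of_nat_mult of_nat_power distrib_right sum.distrib
        sum_distrib_left mult.assoc)
  also have "(\<Sum>k\<le>Suc n. of_nat (stirling_level s n k) * x ^ k) =
      (\<Sum>k\<le>n. of_nat (stirling_level s n k) * x ^ k)"
    by (simp add: top)
  also have "(\<Sum>k\<le>Suc n. of_nat (case k of 0 \<Rightarrow> 0 | Suc k' \<Rightarrow> stirling_level s n k') * x ^ k) =
      x * (\<Sum>k\<le>n. of_nat (stirling_level s n k) * x ^ k)"
    by (subst sum.atMost_Suc_shift) (simp add: sum_distrib_left mult.left_commute)
  finally show ?case
    using Suc.IH by (simp add: algebra_simps)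
qed

definition record_alpha :: "nat \<Rightarrow> nat \<Rightarrow> real" where
  "record_alpha s i = (\<Prod>j=2..i. (1 + (real j - 2) ^ s) / (real j - 1) ^ s)"

(* Sequences and record times are indexed from 1; the value at index 0 is a dummy.
   The infimum of the empty set in enat is infinity. *)
fun record_time :: "(nat \<Rightarrow> real) \<Rightarrow> nat \<Rightarrow> enat" where
  "record_time x 0 = 0"
| "record_time x (Suc 0) = 1"
| "record_time x (Suc (Suc m)) =
     (case record_time x (Suc m) of
        enat l \<Rightarrow> Inf (enat ` {j. 1 \<le> j \<and> x j > x l})
      | \<infinity> \<Rightarrow> \<infinity>)"

end

theory Submission
  imports Defs
begin

text \<open>
  The exponents satisfy \<open>\<alpha>\<^sub>n = (\<alpha>\<^sub>1 + \<dots> + \<alpha>\<^sub>n) / (1 + (n - 1)\<^sup>s)\<close>. If \<open>Z\<close> and \<open>Y\<close> are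
  independent with distribution functions \<open>F\<^sup>a\<close> and \<open>F\<^sup>b\<close>, then
  \<open>P(Z < Y \<le> x) = b / (a + b) * F(x)\<^bsup>a+b\<^esup>\<close>, because \<open>F\<^sup>b(Y)\<close> is uniform on \<open>[0, 1]\<close>. By induction
  on \<open>n\<close>, the number of records among \<open>X\<^sub>1, \<dots>, X\<^sub>n\<close> is independent of their maximum,
  whose distribution function is \<open>F\<close> to the power \<open>\<alpha>\<^sub>1 + \<dots> + \<alpha>\<^sub>n\<close>, and the probabilities of
  the values of the former obey the recurrence of the level-\<open>s\<close> Stirling numbers, up to a factor.
  Finally, \<open>L\<^sub>k = n\<close> means that \<open>n\<close> is a record and that there are \<open>k - 1\<close> records before it.
\<close>

section \<open>Stirling numbers and exponents\<close>

text \<open>The factor at \<open>i = 0\<close> is the polynomial x because \<open>s \<ge> 1\<close>,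
  so the product vanishes at 0.\<close>

lemma stirling_level_0: "n \<ge> 1 \<Longrightarrow> s \<ge> 1 \<Longrightarrow> stirling_level s n 0 = 0"
  by (auto simp: stirling_level_def poly_0_coeff_0[symmetric] poly_prod intro!: bexI[of _ 0])

lemma stirling_level_Suc_Suc:
  "stirling_level s (Suc n) (Suc k) = n ^ s * stirling_level s n (Suc k) + stirling_level s n k"
proof -
  have "(\<Prod>i<Suc n. [:i ^ s, 1::nat:]) =
      smult (n ^ s) (\<Prod>i<n. [:i ^ s, 1:]) + pCons 0 (\<Prod>i<n. [:i ^ s, 1:])"
    by (simp add: mult.commute del: One_nat_def)
  then show ?thesis
    by (simp add: stirling_level_def)
qed

lemma record_alpha_Suc:
  "n \<ge> 1 \<Longrightarrow> record_alpha s (Suc n) = record_alpha s n * (1 + (real n - 1) ^ s) / real n ^ s"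
  by (simp add: record_alpha_def)

lemma record_alpha_pos: "record_alpha s n > 0"
  unfolding record_alpha_def by (intro prod_pos ballI divide_pos_pos add_pos_nonneg) auto

text \<open>The ratio of consecutive exponents makes
  \<open>record_alpha s n * (1 + (real n - 1) ^ s)\<close> equal to
  \<open>record_alpha s (Suc n) * real n ^ s\<close>; adding the next exponent then turns
  \<open>n ^ s\<close> into \<open>1 + n ^ s\<close>.\<close>

lemma sum_record_alpha:
  assumes "n \<ge> 1" "s \<ge> 1"
  shows "(\<Sum>i=1..n. record_alpha s i) = record_alpha s n * (1 + (real n - 1) ^ s)"
  using assms(1)
proof (induction n rule: dec_induct)
  case base
  then show ?case using assms(2) by (simp add: record_alpha_def)
next
  case (step n)
  have "record_alpha s n * (1 + (real n - 1) ^ s) = record_alpha s (Suc n) * real n ^ s"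
    using step.hyps by (simp add: record_alpha_Suc)
  with step show ?case by (simp add: algebra_simps)
qed

section \<open>Record times and record counts\<close>

text \<open>Starting at index 1 skips the dummy value at 0 and makes 1 a record vacuously.\<close>

definition is_record :: "(nat \<Rightarrow> real) \<Rightarrow> nat \<Rightarrow> bool" where
  "is_record x j \<longleftrightarrow> (\<forall>i\<in>{1..<j}. x i < x j)"

definition record_count :: "(nat \<Rightarrow> real) \<Rightarrow> nat \<Rightarrow> nat" where
  "record_count x n = card {j\<in>{1..n}. is_record x j}"

lemma is_record_1: "is_record x (Suc 0)"
  by (simp add: is_record_def)

lemma record_count_Suc:
  "record_count x (Suc n) = record_count x n + (if is_record x (Suc n) then 1 else 0)"
proof -
  have "{j\<in>{1..Suc n}. is_record x j} = {j\<in>{1..n}. is_record x j} \<union>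
      (if is_record x (Suc n) then {Suc n} else {})"
    by (auto simp: le_Suc_eq)
  then show ?thesis
    by (auto simp: record_count_def card_insert_if)
qed

lemma record_count_0: "record_count x 0 = 0"
  by (simp add: record_count_def)

lemma record_count_1: "record_count x (Suc 0) = 1"
  by (simp add: record_count_Suc record_count_0 is_record_1)

lemma record_count_cong:
  "(\<And>i. i \<in> {1..n} \<Longrightarrow> x i = y i) \<Longrightarrow> record_count x n = record_count y n"
  unfolding record_count_def is_record_def by (intro arg_cong[of _ _ card]) auto

lemma record_count_mono: "m \<le> n \<Longrightarrow> record_count x m \<le> record_count x n"
  unfolding record_count_def by (intro card_mono) auto

lemma record_count_pos: "n \<ge> 1 \<Longrightarrow> record_count x n \<ge> 1"
  using record_count_mono[of 1 n x] by (simp add: record_count_1)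

text \<open>A non-record is dominated by some earlier value, so past the last record
  \<open>l\<close> the maximum stays \<open>x l\<close>.\<close>

lemma last_record_max:
  assumes "is_record x l" "l \<ge> 1" "l \<le> m" "\<And>j. l < j \<Longrightarrow> j \<le> m \<Longrightarrow> \<not> is_record x j"
    and "i \<in> {1..m}"
  shows "x i \<le> x l"
  using assms(3-5)
proof (induction m arbitrary: i rule: dec_induct)
  case base
  then show ?case using assms(1) by (cases "i = l") (auto simp: is_record_def less_imp_le)
next
  case (step m)
  have IH: "x i \<le> x l" if "i \<in> {1..m}" for i
    using step.IH[of i] step.prems(1) that by auto
  from step have "\<not> is_record x (Suc m)" by auto
  then obtain j where "j \<in> {1..m}" "x (Suc m) \<le> x j"
    by (fastforce simp: is_record_def not_less)
  with IH[of j] have "x (Suc m) \<le> x l" by linarith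
  with IH step.prems(2) show ?case by (auto simp: le_Suc_eq)
qed

lemma record_count_stable:
  assumes "l \<le> m" "\<And>j. l < j \<Longrightarrow> j \<le> m \<Longrightarrow> \<not> is_record x j"
  shows "record_count x m = record_count x l"
  using assms by (induction m rule: dec_induct) (auto simp: record_count_Suc)

text \<open>Until the next record no value exceeds \<open>x l\<close>, so the first value above
  \<open>x l\<close> is that record. This converts the infimum in \<open>record_time\<close> into a
  condition on \<open>is_record\<close>.\<close>

lemma next_record:
  assumes l: "is_record x l" "l \<ge> 1"
  shows "Inf (enat ` {j. 1 \<le> j \<and> x j > x l}) = enat n \<longleftrightarrow>
    n > l \<and> is_record x n \<and> (\<forall>j. l < j \<and> j < n \<longrightarrow> \<not> is_record x j)"
    (is "Inf (enat ` ?S) = enat n \<longleftrightarrow> ?R")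
proof
  assume inf: "Inf (enat ` ?S) = enat n"
  then have ne: "enat ` ?S \<noteq> {}"
    by (auto simp: Inf_enat_def split: if_splits)
  \<comment> \<open>In \<open>enat\<close> the infimum of a nonempty set is attained.\<close>
  then have "Inf (enat ` ?S) \<in> enat ` ?S"
    unfolding Inf_enat_def by (auto intro: LeastI)
  with inf have n: "1 \<le> n" "x n > x l" by auto
  have least: "x j \<le> x l" if "1 \<le> j" "j < n" for j
  proof (rule ccontr)
    assume "\<not> x j \<le> x l"
    then have "Inf (enat ` ?S) \<le> enat j" using that by (intro Inf_lower) auto
    with inf that show False by simp
  qed
  have "n > l"
  proof (rule ccontr)
    assume "\<not> n > l"
    with n l have "n < l" by (cases "n = l") auto
    with n(1) l(1) have "x n < x l" by (simp add: is_record_def)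
    with n(2) show False by simp
  qed
  moreover have "is_record x n"
    using least n by (force simp: is_record_def)
  moreover have "\<not> is_record x j" if "l < j" "j < n" for j
  proof
    assume "is_record x j"
    then have "x l < x j" using that l by (simp add: is_record_def)
    with least[of j] that show False by simp
  qed
  ultimately show ?R by blast
next
  assume R: ?R
  then have max: "x i \<le> x l" if "i \<in> {1..n - 1}" for i
    using last_record_max[OF l, of "n - 1" i] that by auto
  have "x l < x n" using R l by (auto simp: is_record_def)
  moreover have "n \<le> j" if "j \<in> ?S" for j
  proof (rule ccontr)
    assume "\<not> n \<le> j"
    then have "j \<in> {1..n - 1}" using that by auto
    with max[of j] that show False by auto
  qed
  ultimately show "Inf (enat ` ?S) = enat n"
    using R by (intro antisym Inf_lower Inf_greatest) auto
qed

text \<open>Turns the recursively defined record time into a condition on the first \<open>n\<close>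
  values only. The induction step locates the record that precedes \<open>n\<close>.\<close>

lemma record_time_Suc_eq_iff:
  "record_time x (Suc k) = enat n \<longleftrightarrow> n \<ge> 1 \<and> is_record x n \<and> record_count x n = Suc k"
proof (induction k arbitrary: n)
  case 0
  \<comment> \<open>A record at \<open>n > 1\<close> comes on top of the one at 1, so the count is
    at least 2.\<close>
  have "record_count x n \<noteq> 1" if "n > 1" "is_record x n"
  proof -
    have "record_count x (n - 1) \<ge> 1" using that by (intro record_count_pos) auto
    with that show ?thesis using record_count_Suc[of x "n - 1"] by simp
  qed
  then show ?case
    by (cases n "1::nat" rule: linorder_cases)
      (auto simp: one_enat_def is_record_1 record_count_1)
next
  case (Suc k)
  have "record_time x (Suc (Suc k)) = enat n \<longleftrightarrow>
      (\<exists>l. record_time x (Suc k) = enat l \<and> Inf (enat ` {j. 1 \<le> j \<and> x j > x l}) = enat n)"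
    by (auto split: enat.splits)
  also have "\<dots> \<longleftrightarrow> (\<exists>l\<ge>1. is_record x l \<and> record_count x l = Suc k \<and>
      n > l \<and> is_record x n \<and> (\<forall>j. l < j \<and> j < n \<longrightarrow> \<not> is_record x j))"
    using next_record unfolding Suc.IH by blast
  also have "\<dots> \<longleftrightarrow> n \<ge> 1 \<and> is_record x n \<and> record_count x n = Suc (Suc k)"
  proof safe
    fix l assume l: "l \<ge> 1" "record_count x l = Suc k" "n > l" "is_record x n"
      "\<forall>j. l < j \<and> j < n \<longrightarrow> \<not> is_record x j"
    then show "record_count x n = Suc (Suc k)"
      using record_count_stable[of l "n - 1" x] record_count_Suc[of x "n - 1"] by auto
  next
    assume n: "1 \<le> n" "is_record x n" "record_count x n = Suc (Suc k)"
    then have n2: "n > 1"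
      by (cases n "1::nat" rule: linorder_cases) (auto simp: record_count_1)
    \<comment> \<open>The witness is the last record before \<open>n\<close>; one exists because 1
      is a record and \<open>n > 1\<close>.\<close>
    define S where "S = {j\<in>{1..<n}. is_record x j}"
    have S: "finite S" "S \<noteq> {}"
      using n2 is_record_1[of x] by (auto simp: S_def)
    define l where "l = Max S"
    have l: "l \<in> S" unfolding l_def using S by (rule Max_in)
    have gap: "\<not> is_record x j" if "l < j" "j < n" for j
    proof
      assume "is_record x j"
      then have "j \<in> S" using that by (auto simp: S_def)
      then have "j \<le> l" unfolding l_def using S by simp
      with that show False by simp
    qed
    then have "record_count x l = record_count x (n - 1)"
      using l by (intro record_count_stable[symmetric]) (auto simp: S_def)
    also have "\<dots> = Suc k" using n record_count_Suc[of x "n - 1"] by simp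
    finally show "\<exists>l\<ge>1. is_record x l \<and> record_count x l = Suc k \<and>
      n > l \<and> is_record x n \<and> (\<forall>j. l < j \<and> j < n \<longrightarrow> \<not> is_record x j)"
      using l gap n by (intro exI[of _ l]) (auto simp: S_def)
  qed auto
  finally show ?case .
qed

section \<open>Comparing independent variables whose distribution functions are powers\<close>

text \<open>Probability integral transform, by comparing distribution functions. The cdf may have
  flat pieces and need not be invertible; the intermediate value theorem still gives a preimage for
  each level strictly between 0 and 1.\<close>

lemma (in real_distribution) distr_cdf_eq_uniform:
  assumes cont: "continuous_on UNIV (cdf M)"
  shows "distr M borel (cdf M) = uniform_measure lborel {0..1}"
proof (rule cdf_unique)
  have [measurable]: "cdf M \<in> borel_measurable borel"
    using cont by (rule borel_measurable_continuous_onI)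
  show "real_distribution (distr M borel (cdf M))"
    by simp
  show "real_distribution (uniform_measure lborel {0..1::real})"
    unfolding real_distribution_def real_distribution_axioms_def
    by (auto intro!: prob_space_uniform_measure)
  have ivt: "\<exists>z. cdf M z = u" if "0 < u" "u < 1" for u
  proof -
    obtain a where a: "cdf M a < u"
      using order_tendstoD(2)[OF cdf_lim_at_bot \<open>0 < u\<close>] by (auto dest: eventually_happens)
    obtain b where b: "u < cdf M b"
      using order_tendstoD(1)[OF cdf_lim_at_top_prob \<open>u < 1\<close>] by (auto dest: eventually_happens)
    have "a \<le> b" using a b cdf_nondecreasing[of b a] by linarith
    then show ?thesis
      using IVT'[of "cdf M" a u b] a b continuous_on_subset[OF cont] by auto
  qed
  show "cdf (distr M borel (cdf M)) = cdf (uniform_measure lborel {0..1})"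
  proof
    fix u :: real
    define S where "S = {y. cdf M y \<le> u}"
    have S[measurable]: "S \<in> sets borel" unfolding S_def by measurable
    have L: "cdf (distr M borel (cdf M)) u = prob S"
      by (simp add: cdf_def[of "distr M borel (cdf M)"] measure_distr S_def vimage_def)
    have R: "cdf (uniform_measure lborel {0..1}) u = measure lborel ({0..1} \<inter> {..u})"
      by (simp add: cdf_def)
    consider "u < 0" | "0 \<le> u" "u < 1" | "1 \<le> u" by linarith
    then show "cdf (distr M borel (cdf M)) u = cdf (uniform_measure lborel {0..1}) u"
    proof cases
      case 1
      then have "S = {}" "{0..1} \<inter> {..u} = {}"
        using cdf_nonneg by (auto simp: S_def) (smt (verit))
      then show ?thesis unfolding L R by simp
    next
      case 2
      \<comment> \<open>Because of flat pieces, a point of level \<open>u\<close> need not bound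
        \<open>S\<close>; a point of a higher level \<open>v\<close> does, and then \<open>v\<close>
        decreases to \<open>u\<close>.\<close>
      have "prob S \<le> v" if "u < v" "v < 1" for v
      proof -
        have "0 < v" using 2 that by simp
        with ivt that obtain z where z: "cdf M z = v" by blast
        have "S \<subseteq> {..z}"
        proof
          fix y assume "y \<in> S"
          then show "y \<in> {..z}"
            using cdf_nondecreasing[of z y] z that by (cases "y \<le> z") (auto simp: S_def)
        qed
        then have "prob S \<le> cdf M z" unfolding cdf_def by (intro finite_measure_mono) auto
        with z show ?thesis by simp
      qed
      then have "prob S \<le> u" by (rule dense_ge_bounded[OF 2(2)])
      moreover have "u \<le> prob S"
      \<comment> \<open>Level 0 need not be attained, but there the bound is trivial.\<close>
      proof (cases "u = 0")
        case False
        then obtain z where z: "cdf M z = u" using ivt[of u] 2 by auto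
        have "{..z} \<subseteq> S" using cdf_nondecreasing z by (auto simp: S_def)
        then have "cdf M z \<le> prob S" unfolding cdf_def by (intro finite_measure_mono) auto
        with z show ?thesis by simp
      qed simp
      moreover have "{0..1} \<inter> {..u} = {0..u}" using 2 by auto
      ultimately show ?thesis unfolding L R using 2 by simp
    next
      case 3
      then have "S = UNIV" "{0..1} \<inter> {..u} = {0..1}"
        using cdf_bounded_prob by (auto simp: S_def intro: order_trans)
      then show ?thesis unfolding L R using prob_space by simp
    qed
  qed
qed

text \<open>Substituting u = \<open>cdf M y\<close> leaves the integral of \<open>u powr c\<close>
  from 0 to \<open>cdf M x\<close>, which converges at 0 since \<open>c > -1\<close>.\<close>

lemma (in real_distribution) nn_integral_cdf_powr:
  assumes cont: "continuous_on UNIV (cdf M)" and c: "c > -1"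
  shows "(\<integral>\<^sup>+y. ennreal (cdf M y powr c) * indicator {..x} y \<partial>M) =
    ennreal (cdf M x powr (c + 1) / (c + 1))"
proof -
  let ?G = "cdf M"
  have [measurable]: "?G \<in> borel_measurable borel"
    using cont by (rule borel_measurable_continuous_onI)
  have G: "0 \<le> ?G x" "?G x \<le> 1" using cdf_nonneg cdf_bounded_prob by auto
  \<comment> \<open>\<open>{..x}\<close> and \<open>{y. ?G y \<le> ?G x}\<close> can differ only by
    a flat piece to the right of \<open>x\<close>. Their probabilities agree, so the difference is a
    null set.\<close>
  have "prob {y. ?G y \<le> ?G x} = cdf (distr M borel ?G) (?G x)"
    by (simp add: cdf_def[of "distr M borel ?G"] measure_distr vimage_def)
  also have "\<dots> = measure lborel ({0..1} \<inter> {..?G x})"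
    by (simp add: distr_cdf_eq_uniform[OF cont] cdf_def[of "uniform_measure _ _"])
  also have "{0..1} \<inter> {..?G x} = {0..?G x}" using G by auto
  finally have "prob {y. ?G y \<le> ?G x} = prob {..x}" using G by (simp add: cdf_def)
  then have "prob ({y. ?G y \<le> ?G x} - {..x}) = 0"
    using cdf_nondecreasing by (subst finite_measure_Diff) auto
  then have "AE y in M. y \<notin> {y. ?G y \<le> ?G x} - {..x}"
    by (subst (asm) prob_eq_0) auto
  then have "AE y in M. indicator {..x} y = (indicator {..?G x} (?G y) :: ennreal)"
    by eventually_elim (use cdf_nondecreasing in \<open>auto split: split_indicator\<close>)
  then have "(\<integral>\<^sup>+y. ennreal (?G y powr c) * indicator {..x} y \<partial>M) =
      (\<integral>\<^sup>+y. ennreal (?G y powr c) * indicator {..?G x} (?G y) \<partial>M)"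
    by (intro nn_integral_cong_AE) auto
  also have "\<dots> = (\<integral>\<^sup>+u. ennreal (u powr c) * indicator {..?G x} u \<partial>distr M borel ?G)"
    by (subst nn_integral_distr) auto
  also have "\<dots> = (\<integral>\<^sup>+u. ennreal (u powr c) * indicator {..?G x} u * indicator {0..1} u \<partial>lborel)"
    unfolding distr_cdf_eq_uniform[OF cont]
    by (subst nn_integral_uniform_measure) (auto simp: divide_ennreal_def)
  also have "\<dots> = (\<integral>\<^sup>+u. ennreal (u powr c) * indicator {0..?G x} u \<partial>lborel)"
    using G by (intro nn_integral_cong) (auto split: split_indicator)
  also have "\<dots> = ennreal (?G x powr (c + 1) / (c + 1))"
    using has_integral_powr_from_0[OF c G(1)] by (intro nn_integral_has_integral_lebesgue') auto
  finally show ?thesis .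
qed

section \<open>Restricted laws and independence on a probability space\<close>

context prob_space
begin

text \<open>Both claims are read off \<open>N\<close>, the law of \<open>Z\<close> restricted to the
  event \<open>P\<close>: a finite measure with distribution function \<open>H\<close>. The left
  limit at \<open>x\<close> is its mass strictly below \<open>x\<close>, the limit at infinity its
  total mass.\<close>

lemma
  fixes Z :: "'a \<Rightarrow> real"
  assumes [measurable]: "Measurable.pred M P" "random_variable borel Z"
    and H: "\<And>x. \<P>(\<omega> in M. P \<omega> \<and> Z \<omega> \<le> x) = H x"
  shows prob_less_of_cdf: "continuous_on UNIV H \<Longrightarrow> \<P>(\<omega> in M. P \<omega> \<and> Z \<omega> < x) = H x"
    and prob_of_cdf_lim: "(H \<longlongrightarrow> c) at_top \<Longrightarrow> \<P>(\<omega> in M. P \<omega>) = c"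
proof -
  define N where "N = distr (density M (indicator {\<omega>\<in>space M. P \<omega>})) borel Z"
  have emeasure_N: "emeasure N B = emeasure M {\<omega>\<in>space M. P \<omega> \<and> Z \<omega> \<in> B}" if [measurable]: "B \<in> sets borel" for B
    unfolding N_def by (subst emeasure_distr, simp, simp, subst emeasure_restricted)
      (auto intro!: arg_cong[of _ _ "emeasure M"])
  then have measure_N: "measure N B = \<P>(\<omega> in M. P \<omega> \<and> Z \<omega> \<in> B)" if "B \<in> sets borel" for B
    using that by (simp add: measure_def)
  have "finite_measure N"
    by (rule finite_measureI) (simp add: N_def emeasure_N[unfolded N_def])
  then interpret N: finite_borel_measure N
    by (simp add: finite_borel_measure_def finite_borel_measure_axioms_def N_def)
  have cdf_N: "cdf N = H"
    using H by (auto simp: cdf_def measure_N)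
  {
    assume "continuous_on UNIV H"
    then have "isCont H x" by (simp add: continuous_on_eq_continuous_at)
    then have "(H \<longlongrightarrow> H x) (at_left x)"
      by (auto simp: isCont_def intro: tendsto_within_subset)
    moreover have "(H \<longlongrightarrow> measure N {..<x}) (at_left x)"
      using N.cdf_at_left[of x] by (simp add: cdf_N)
    ultimately have "measure N {..<x} = H x"
      by (intro tendsto_unique[of "at_left x"]) auto
    then show "\<P>(\<omega> in M. P \<omega> \<and> Z \<omega> < x) = H x"
      by (simp add: measure_N)
  next
    assume "(H \<longlongrightarrow> c) at_top"
    then have "measure N (space N) = c"
      using N.cdf_lim_at_top by (intro tendsto_unique[of at_top]) (auto simp: cdf_N)
    then show "\<P>(\<omega> in M. P \<omega>) = c"
      by (subst (asm) N.borel_UNIV, subst (asm) measure_N) auto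
  }
qed

text \<open>States independence of a block and one further variable in the product-measure form
  needed for iterated integration. \<open>indep_var_restrict\<close> treats the single variable as a
  family over \<open>{i}\<close>, so its component is projected out.\<close>

lemma joint_distr_restrict:
  assumes "indep_vars M' X I" "J \<subseteq> I" "i \<in> I - J"
  shows "distr M (PiM J M') (\<lambda>\<omega>. \<lambda>j\<in>J. X j \<omega>) \<Otimes>\<^sub>M distr M (M' i) (X i) =
    distr M (PiM J M' \<Otimes>\<^sub>M M' i) (\<lambda>\<omega>. (\<lambda>j\<in>J. X j \<omega>, X i \<omega>))"
proof -
  let ?W = "\<lambda>\<omega>. \<lambda>j\<in>J. X j \<omega>" and ?V = "\<lambda>\<omega>. \<lambda>j\<in>{i}. X j \<omega>"
  have indep: "indep_var (PiM J M') ?W (PiM {i} M') ?V"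
    using assms by (intro indep_var_restrict) auto
  then have [measurable]: "random_variable (PiM J M') ?W" "random_variable (PiM {i} M') ?V"
    by (auto dest: indep_var_rv1 indep_var_rv2)
  have [measurable]: "(\<lambda>v. v i) \<in> measurable (PiM {i} M') (M' i)"
    by (rule measurable_component_singleton) simp
  have V: "distr M (M' i) (X i) = distr (distr M (PiM {i} M') ?V) (M' i) (\<lambda>v. v i)"
    by (subst distr_distr) (auto simp: o_def)
  interpret V: prob_space "distr M (M' i) (X i)"
    using assms by (intro prob_space_distr) (auto simp: indep_vars_def)
  have "distr M (PiM J M') ?W \<Otimes>\<^sub>M distr M (M' i) (X i) =
      distr (distr M (PiM J M') ?W) (PiM J M') (\<lambda>w. w) \<Otimes>\<^sub>M
      distr (distr M (PiM {i} M') ?V) (M' i) (\<lambda>v. v i)"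
    unfolding V by (subst distr_distr) (auto simp: o_def)
  also have "\<dots> = distr (distr M (PiM J M') ?W \<Otimes>\<^sub>M distr M (PiM {i} M') ?V)
      (PiM J M' \<Otimes>\<^sub>M M' i) (\<lambda>(w, v). (w, v i))"
    using V.sigma_finite_measure_axioms unfolding V by (intro pair_measure_distr) auto
  also have "\<dots> = distr M (PiM J M' \<Otimes>\<^sub>M M' i) (\<lambda>\<omega>. (?W \<omega>, X i \<omega>))"
    using indep unfolding indep_var_distribution_eq
    by (simp add: distr_distr o_def split_beta)
  finally show ?thesis .
qed

text \<open>Fix Y = y: by independence the rest of the event has probability
  \<open>c * F y powr a\<close>. In terms of the cdf \<open>G\<close> of \<open>Y\<close> this is
  \<open>c * G y powr (a / b)\<close>, which \<open>nn_integral_cdf_powr\<close> integrates over y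
  \<le> x. Later \<open>W\<close> is the block of past values, \<open>P\<close> fixes its record
  count and \<open>f\<close> is its maximum.\<close>

lemma prob_indep_less_powr:
  assumes joint: "distr M N W \<Otimes>\<^sub>M distr M borel Y = distr M (N \<Otimes>\<^sub>M borel) (\<lambda>\<omega>. (W \<omega>, Y \<omega>))"
    and [measurable]: "random_variable N W" "random_variable borel Y"
      "Measurable.pred N P" "f \<in> borel_measurable N"
    and F: "continuous_on UNIV F" "\<And>x. F x \<ge> 0"
    and W: "\<And>x. \<P>(\<omega> in M. P (W \<omega>) \<and> f (W \<omega>) \<le> x) = c * F x powr a"
    and Y: "\<And>x. cdf (distr M borel Y) x = F x powr b"
    and pos: "a > 0" "b > 0" "c \<ge> 0"
  shows "\<P>(\<omega> in M. P (W \<omega>) \<and> f (W \<omega>) < Y \<omega> \<and> Y \<omega> \<le> x) =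
    c * b / (a + b) * F x powr (a + b)"
proof -
  interpret W: prob_space "distr M N W" by (rule prob_space_distr) simp
  interpret Y: real_distribution "distr M borel Y" by simp
  interpret WY: pair_prob_space "distr M N W" "distr M borel Y" ..
  \<comment> \<open>A positive exponent keeps the power continuous where \<open>F\<close>
    vanishes.\<close>
  have cont: "continuous_on UNIV (\<lambda>x. F x powr r)" if "r > 0" for r
    using F that by (intro continuous_on_powr' continuous_on_const) auto
  define G where "G = cdf (distr M borel Y)"
  have cont_G: "continuous_on UNIV G"
    using cont[of b] pos Y by (simp add: G_def)
  then have [measurable]: "G \<in> borel_measurable borel"
    by (rule borel_measurable_continuous_onI)
  have F_powr: "F y powr r = G y powr (r / b)" for y r
    using pos by (simp add: G_def Y powr_powr)
  \<comment> \<open>Records are strict, so the law of \<open>f (W \<omega>)\<close> is needed with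
    \<open><\<close>; continuity supplies it.\<close>
  have less: "\<P>(\<omega> in M. P (W \<omega>) \<and> f (W \<omega>) < y) = c * F y powr a" for y
    using pos by (intro prob_less_of_cdf W continuous_on_mult continuous_on_const cont) auto
  let ?S = "{p \<in> space (N \<Otimes>\<^sub>M borel). P (fst p) \<and> f (fst p) < snd p \<and> snd p \<le> x}"
  have "ennreal (\<P>(\<omega> in M. P (W \<omega>) \<and> f (W \<omega>) < Y \<omega> \<and> Y \<omega> \<le> x)) =
      emeasure M ((\<lambda>\<omega>. (W \<omega>, Y \<omega>)) -` ?S \<inter> space M)"
    unfolding emeasure_eq_measure[symmetric]
    by (rule arg_cong[of _ _ "emeasure M"])
      (auto simp: space_pair_measure dest: measurable_space[OF \<open>random_variable N W\<close>])
  also have "\<dots> = emeasure (distr M (N \<Otimes>\<^sub>M borel) (\<lambda>\<omega>. (W \<omega>, Y \<omega>))) ?S"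
    by (subst emeasure_distr) auto
  also have "\<dots> = (\<integral>\<^sup>+y. emeasure (distr M N W) ((\<lambda>w. (w, y)) -` ?S) \<partial>distr M borel Y)"
    unfolding joint[symmetric] by (subst WY.emeasure_pair_measure_alt2) auto
  also have "\<dots> = (\<integral>\<^sup>+y. ennreal c * (ennreal (G y powr (a / b)) * indicator {..x} y) \<partial>distr M borel Y)"
  proof (intro nn_integral_cong)
    fix y
    have "(\<lambda>w. (w, y)) -` ?S = {w\<in>space N. P w \<and> f w < y \<and> y \<le> x}"
      by (auto simp: space_pair_measure)
    then have "emeasure (distr M N W) ((\<lambda>w. (w, y)) -` ?S) =
        emeasure M (W -` {w\<in>space N. P w \<and> f w < y \<and> y \<le> x} \<inter> space M)"
      by (simp add: emeasure_distr)
    also have "\<dots> = emeasure M {\<omega>\<in>space M. P (W \<omega>) \<and> f (W \<omega>) < y \<and> y \<le> x}"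
      by (rule arg_cong[of _ _ "emeasure M"]) (auto dest: measurable_space[OF \<open>random_variable N W\<close>])
    also have "\<dots> = ennreal c * (ennreal (G y powr (a / b)) * indicator {..x} y)"
      using less[of y] pos
      by (auto simp: emeasure_eq_measure F_powr ennreal_mult split: split_indicator)
    finally show "emeasure (distr M N W) ((\<lambda>w. (w, y)) -` ?S) = \<dots>" .
  qed
  also have "\<dots> = ennreal c * ennreal (G x powr (a / b + 1) / (a / b + 1))"
    using cont_G pos Y.nn_integral_cdf_powr[of "a / b" x]
    by (subst nn_integral_cmult)
      (auto simp: G_def[symmetric] less_trans[of _ 0])
  also have "\<dots> = ennreal (c * b / (a + b) * F x powr (a + b))"
  proof -
    have "c * b / (a + b) * F x powr (a + b) = c * (G x powr (a / b + 1) / (a / b + 1))"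
      using pos by (simp add: F_powr[of x "a + b"] add_divide_distrib[symmetric] field_simps)
    then show ?thesis using pos by (simp add: ennreal_mult[symmetric])
  qed
  finally show ?thesis using pos by simp
qed

end

section \<open>Joint law of the record count and the running maximum\<close>

lemma measurable_record_count [measurable]:
  "(\<lambda>w. record_count w n) \<in> measurable (PiM {1..n} (\<lambda>_. borel)) (count_space UNIV)"
  unfolding record_count_def
proof (rule measurable_card)
  fix j
  have "Measurable.pred (PiM {1..n} (\<lambda>_. borel)) (\<lambda>w. is_record w j)" if "j \<in> {1..n}"
    unfolding is_record_def using that
    by (intro pred_intros_finite borel_measurable_pred_less measurable_component_singleton) auto
  then show "{w \<in> space (PiM {1..n} (\<lambda>_. borel)). j \<in> {j \<in> {1..n}. is_record w j}} \<in>
      sets (PiM {1..n} (\<lambda>_. borel))"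
    by (cases "j \<in> {1..n}") (simp_all add: pred_def)
qed

lemma measurable_Max_PiM [measurable]:
  "(\<lambda>w :: nat \<Rightarrow> real. Max (w ` {m..n})) \<in> borel_measurable (PiM {m..n} (\<lambda>_. borel))"
  using borel_measurable_Max[of "{m..n}" "\<lambda>i w. w i :: real" "PiM {m..n} (\<lambda>_. borel)"] by simp

lemma is_record_Suc_iff_Max:
  assumes "n \<ge> 1"
  shows "is_record x (Suc n) \<longleftrightarrow> Max (x ` {1..n}) < x (Suc n)"
  using assms by (subst Max_less_iff) (auto simp: is_record_def less_Suc_eq_le)

section \<open>The sequence of the theorem, fixed in a locale\<close>

locale level_sequence = prob_space M for M :: "'a measure" +
  fixes X :: "nat \<Rightarrow> 'a \<Rightarrow> real" and F :: "real \<Rightarrow> real" and s :: nat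
  assumes indep: "indep_vars (\<lambda>_. borel) X {1..}"
    and X_cdf: "\<And>i x. i \<ge> 1 \<Longrightarrow> cdf (distr M borel (X i)) x = F x powr record_alpha s i"
    and F_cont: "continuous_on UNIV F"
    and F_nonneg: "\<And>x. F x \<ge> 0"
    and F_top: "(F \<longlongrightarrow> 1) at_top"
    and s: "s \<ge> 1"
begin

text \<open>For \<open>n \<ge> 1\<close> this turns out to be the probability of \<open>k\<close>
  records among the first \<open>n\<close> values. The denominator is the generating product of the
  Stirling numbers at x = 1.\<close>

definition joint_const :: "nat \<Rightarrow> nat \<Rightarrow> real" where
  "joint_const n k = real (stirling_level s n k) / (\<Prod>i=1..n. (1 + (real i - 1) ^ s))"

lemma joint_const_nonneg: "joint_const n k \<ge> 0"
  unfolding joint_const_def by (intro divide_nonneg_nonneg prod_nonneg add_nonneg_nonneg ballI) auto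

lemma random_variable_X [measurable]: "i \<ge> 1 \<Longrightarrow> random_variable borel (X i)"
  using indep by (auto simp: indep_vars_def)

abbreviation count :: "nat \<Rightarrow> 'a \<Rightarrow> nat" where
  "count n \<omega> \<equiv> record_count (\<lambda>i. X i \<omega>) n"

abbreviation running_max :: "nat \<Rightarrow> 'a \<Rightarrow> real" where
  "running_max n \<omega> \<equiv> Max ((\<lambda>i. X i \<omega>) ` {1..n})"

lemma count_restrict: "record_count (\<lambda>i\<in>{1..n}. X i \<omega>) n = count n \<omega>"
  by (rule record_count_cong) auto

lemma running_max_restrict: "Max ((\<lambda>i\<in>{1..n}. X i \<omega>) ` {1..n}) = running_max n \<omega>"
  by (intro arg_cong[of _ _ Max] image_cong) auto

lemma measurable_count [measurable]: "count n \<in> measurable M (count_space UNIV)"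
proof -
  have "random_variable (PiM {1..n} (\<lambda>_. borel)) (\<lambda>\<omega>. \<lambda>i\<in>{1..n}. X i \<omega>)"
    by measurable
  from measurable_compose[OF this measurable_record_count] show ?thesis
    by (simp only: count_restrict)
qed

lemma measurable_running_max [measurable]: "random_variable borel (running_max n)"
  by (intro borel_measurable_Max) auto

text \<open>This is the ratio \<open>b / (a + b)\<close> of the comparison lemma: the chance that
  value \<open>n + 1\<close> is a record.\<close>

lemma record_alpha_over_sum:
  assumes "n \<ge> 1"
  shows "record_alpha s (Suc n) / (\<Sum>i=1..Suc n. record_alpha s i) = 1 / (1 + real n ^ s)"
  using record_alpha_pos[of s "Suc n"] by (subst sum_record_alpha) (use s in auto)

lemma joint_const_Suc_0:
  "joint_const (Suc n) 0 = joint_const n 0 - joint_const n 0 / (1 + real n ^ s)"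
\<comment> \<open>For \<open>n = 0\<close> the term \<open>joint_const 0 0\<close> is 1, but
  \<open>1 + 0 ^ s = 1\<close>, so it cancels; otherwise all terms vanish.\<close>
proof (cases "n = 0")
  case False
  then show ?thesis using s by (simp add: joint_const_def stirling_level_0)
next
  case True
  then show ?thesis using s by (simp add: joint_const_def stirling_level_0 power_0_left)
qed

text \<open>The Stirling recurrence divided by \<open>p * q\<close>: the weight
  \<open>n ^ s / q\<close> is \<open>1 - 1 / q\<close>, the probability of no new record.\<close>

lemma joint_const_Suc_Suc:
  "joint_const (Suc n) (Suc k) = joint_const n (Suc k) - joint_const n (Suc k) / (1 + real n ^ s)
      + joint_const n k / (1 + real n ^ s)"
proof -
  define p where "p = (\<Prod>i=1..n. (1 + (real i - 1) ^ s))"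
  define q where "q = 1 + real n ^ s"
  have p: "p > 0" unfolding p_def by (intro prod_pos ballI add_pos_nonneg) auto
  have q: "q > 0" unfolding q_def by (intro add_pos_nonneg) auto
  have pq: "(\<Prod>i=1..Suc n. (1 + (real i - 1) ^ s)) = p * q" by (simp add: p_def q_def)
  have ns: "real (n ^ s) = q - 1" by (simp add: q_def)
  show ?thesis
    using p q
    unfolding joint_const_def stirling_level_Suc_Suc pq p_def[symmetric] q_def[symmetric]
      of_nat_add of_nat_mult ns
    by (simp add: field_simps)
qed

text \<open>The law at \<open>n\<close> is an assumption so that this serves both inside the
  induction proving that law and after it.\<close>

lemma prob_count_new_record:
  assumes n: "n \<ge> 1"
    and law: "\<And>x. \<P>(\<omega> in M. count n \<omega> = k \<and> running_max n \<omega> \<le> x) =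
      joint_const n k * F x powr (\<Sum>i=1..n. record_alpha s i)"
  shows "\<P>(\<omega> in M. count n \<omega> = k \<and> running_max n \<omega> < X (Suc n) \<omega> \<and> X (Suc n) \<omega> \<le> x) =
      joint_const n k / (1 + real n ^ s) * F x powr (\<Sum>i=1..Suc n. record_alpha s i)"
proof -
  let ?a = "\<Sum>i=1..n. record_alpha s i" and ?b = "record_alpha s (Suc n)"
  have "?a > 0" using n by (intro sum_pos record_alpha_pos) auto
  note joint = joint_distr_restrict[OF indep, of "{1..n}" "Suc n"]
  have "\<P>(\<omega> in M. count n \<omega> = k \<and> running_max n \<omega> < X (Suc n) \<omega> \<and> X (Suc n) \<omega> \<le> x) =
      joint_const n k * ?b / (?a + ?b) * F x powr (?a + ?b)"
  proof (rule prob_indep_less_powr[OF joint, where P = "\<lambda>w. record_count w n = k" and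
        f = "\<lambda>w. Max (w ` {1..n})", unfolded count_restrict running_max_restrict])
    show "random_variable (PiM {1..n} (\<lambda>_. borel)) (\<lambda>\<omega>. \<lambda>i\<in>{1..n}. X i \<omega>)"
      by measurable
    show "(\<lambda>w :: nat \<Rightarrow> real. Max (w ` {1..n})) \<in> borel_measurable (PiM {1..n} (\<lambda>_. borel))"
      by measurable
    show "Measurable.pred (PiM {1..n} (\<lambda>_. borel)) (\<lambda>w. record_count w n = k)"
      using measurable_record_count by measurable
  qed (use \<open>?a > 0\<close> X_cdf F_cont F_nonneg law record_alpha_pos joint_const_nonneg in auto)
  also have "joint_const n k * ?b / (?a + ?b) = joint_const n k * (?b / (\<Sum>i=1..Suc n. record_alpha s i))"
    by simp
  also have "\<dots> = joint_const n k / (1 + real n ^ s)"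
    using n by (simp only: record_alpha_over_sum) simp
  finally show ?thesis by simp
qed

text \<open>The induction step splits on whether value \<open>n + 1\<close> is a record. The case
  without a record is a set difference, \<open>both k - new k\<close>, so only the comparison in
  \<open>prob_count_new_record\<close> has to be integrated.\<close>

lemma prob_count_running_max:
  assumes "n \<ge> 1"
  shows "\<P>(\<omega> in M. count n \<omega> = k \<and> running_max n \<omega> \<le> x) =
    joint_const n k * F x powr (\<Sum>i=1..n. record_alpha s i)"
  using assms
proof (induction n arbitrary: k x rule: dec_induct)
  case base
  \<comment> \<open>A single value gives count 1, and \<open>s \<ge> 1\<close> makes the denominator
    \<open>1 + 0 ^ s\<close> equal to 1.\<close>
  have const: "joint_const 1 k = (if k = 1 then 1 else 0)"
    using s by (auto simp: joint_const_def stirling_level_def coeff_pCons power_0_left split: nat.split)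
  have "\<P>(\<omega> in M. X 1 \<omega> \<le> x) = F x powr record_alpha s 1"
    using X_cdf[of 1 x] by (simp add: cdf_def measure_distr vimage_def Int_def conj_commute)
  then show ?case
    using const by (simp add: record_count_1)
next
  case (step n)
  let ?Y = "X (Suc n)"
  have max: "running_max (Suc n) \<omega> = max (?Y \<omega>) (running_max n \<omega>)" for \<omega>
    using step.hyps by (simp add: atLeastAtMostSuc_conv)
  define new where "new k = {\<omega>\<in>space M. count n \<omega> = k \<and> running_max n \<omega> < ?Y \<omega> \<and> ?Y \<omega> \<le> x}" for k
  have new[measurable]: "new k \<in> events" for k unfolding new_def by measurable
  have prob_new: "prob (new k) =
      joint_const n k / (1 + real n ^ s) * F x powr (\<Sum>i=1..Suc n. record_alpha s i)" for k
    unfolding new_def using step.hyps step.IH by (intro prob_count_new_record) auto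
  \<comment> \<open>The order of \<open>?Y\<close> and the running maximum is left open here, so
    independence alone gives the probability, and the exponents of \<open>F\<close> add up.\<close>
  define both where "both k = {\<omega>\<in>space M. (count n \<omega> = k \<and> running_max n \<omega> \<le> x) \<and> ?Y \<omega> \<le> x}" for k
  have both[measurable]: "both k \<in> events" for k unfolding both_def by measurable
  have prob_both: "prob (both k) = joint_const n k * F x powr (\<Sum>i=1..Suc n. record_alpha s i)" for k
  proof -
    have past: "Measurable.pred (PiM {1..n} (\<lambda>_. borel))
        (\<lambda>w. record_count w n = k \<and> Max (w ` {1..n}) \<le> x)"
      by measurable
    have "indep_var (count_space UNIV) ((\<lambda>w. record_count w n = k \<and> Max (w ` {1..n}) \<le> x) \<circ>
        (\<lambda>\<omega>. \<lambda>i\<in>{1..n}. X i \<omega>)) (count_space UNIV)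
        ((\<lambda>v. v (Suc n) \<le> x) \<circ> (\<lambda>\<omega>. \<lambda>i\<in>{Suc n}. X i \<omega>))"
    proof (rule indep_var_compose[OF indep_var_restrict[OF indep, of "{1..n}" "{Suc n}"]])
      have [measurable]: "(\<lambda>v. v (Suc n)) \<in> borel_measurable (PiM {Suc n} (\<lambda>_. borel :: real measure))"
        by (rule measurable_component_singleton) simp
      show "Measurable.pred (PiM {Suc n} (\<lambda>_. borel)) (\<lambda>v. v (Suc n) \<le> x)"
        by measurable
    qed (use past in auto)
    then have "indep_var (count_space UNIV) (\<lambda>\<omega>. count n \<omega> = k \<and> running_max n \<omega> \<le> x)
        (count_space UNIV) (\<lambda>\<omega>. ?Y \<omega> \<le> x)"
      by (simp add: o_def count_restrict running_max_restrict del: One_nat_def)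
    from prob_indep_random_variable[OF this, of "{True}" "{True}"]
    have "prob (both k) = \<P>(\<omega> in M. count n \<omega> = k \<and> running_max n \<omega> \<le> x) * \<P>(\<omega> in M. ?Y \<omega> \<le> x)"
      by (simp add: both_def)
    moreover have "\<P>(\<omega> in M. ?Y \<omega> \<le> x) = F x powr record_alpha s (Suc n)"
      using X_cdf[of "Suc n" x] by (simp add: cdf_def measure_distr vimage_def Int_def conj_commute)
    ultimately show ?thesis
      using step.IH by (simp add: powr_add)
  qed
  have diff: "prob (both k - new k) = prob (both k) - prob (new k)" for k
    by (rule finite_measure_Diff) (auto simp: both_def new_def)
  have rec: "count (Suc n) \<omega> = count n \<omega> + (if running_max n \<omega> < ?Y \<omega> then 1 else 0)" for \<omega>
    using step.hyps by (simp add: record_count_Suc is_record_Suc_iff_Max)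
  show ?case
  proof (cases k)
    \<comment> \<open>A new record never leaves the count at 0.\<close>
    case 0
    have "{\<omega>\<in>space M. count (Suc n) \<omega> = k \<and> running_max (Suc n) \<omega> \<le> x} = both 0 - new 0"
      unfolding both_def new_def rec max 0 by auto
    then show ?thesis
      by (simp only: diff prob_both prob_new) (simp add: 0 joint_const_Suc_0 algebra_simps)
  next
    \<comment> \<open>Count \<open>Suc l\<close> arises from \<open>Suc l\<close> without a new
      record or from \<open>l\<close> with one.\<close>
    case (Suc l)
    have "{\<omega>\<in>space M. count (Suc n) \<omega> = k \<and> running_max (Suc n) \<omega> \<le> x} =
        (both (Suc l) - new (Suc l)) \<union> new l"
      unfolding both_def new_def rec max Suc by auto
    moreover have "prob ((both (Suc l) - new (Suc l)) \<union> new l) = prob (both (Suc l) - new (Suc l)) + prob (new l)"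
      by (rule finite_measure_Union) (auto simp: both_def new_def)
    ultimately show ?thesis
      by (simp only: diff prob_both prob_new) (simp add: Suc joint_const_Suc_Suc algebra_simps)
  qed
qed

text \<open>Both indices are shifted by one against the theorem, and \<open>n \<ge> 1\<close>
  guarantees a nonempty past. Letting \<open>x\<close> tend to infinity in
  \<open>prob_count_new_record\<close> removes the bound on the new value.\<close>

lemma prob_record_time:
  assumes n: "n \<ge> 1"
  shows "\<P>(\<omega> in M. record_time (\<lambda>i. X i \<omega>) (Suc k) = enat (Suc n)) =
    joint_const n k / (1 + real n ^ s)"
proof -
  let ?c = "joint_const n k / (1 + real n ^ s)" and ?a = "\<Sum>i=1..Suc n. record_alpha s i"
  have "((\<lambda>x. ?c * F x powr ?a) \<longlongrightarrow> ?c * 1 powr ?a) at_top"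
    by (intro tendsto_intros F_top) auto
  then have lim: "((\<lambda>x. ?c * F x powr ?a) \<longlongrightarrow> ?c) at_top" by simp
  have "\<P>(\<omega> in M. count n \<omega> = k \<and> running_max n \<omega> < X (Suc n) \<omega>) = ?c"
  proof (rule prob_of_cdf_lim[OF _ _ _ lim])
    show "\<P>(\<omega> in M. (count n \<omega> = k \<and> running_max n \<omega> < X (Suc n) \<omega>) \<and> X (Suc n) \<omega> \<le> x) =
        ?c * F x powr ?a" for x
      unfolding conj_assoc by (rule prob_count_new_record[OF n prob_count_running_max[OF n]])
  qed measurable
  moreover have "record_time (\<lambda>i. X i \<omega>) (Suc k) = enat (Suc n) \<longleftrightarrow>
      count n \<omega> = k \<and> running_max n \<omega> < X (Suc n) \<omega>" for \<omega>
    using n unfolding record_time_Suc_eq_iff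
    by (auto simp: record_count_Suc is_record_Suc_iff_Max)
  ultimately show ?thesis by simp
qed

end

theorem mainTheorem2:
  fixes s k n :: nat
    and M :: "'a measure"
    and X :: "nat \<Rightarrow> 'a \<Rightarrow> real"
    and D :: "real measure"
    and F :: "real \<Rightarrow> real"
  assumes s: "s \<ge> 1"
    and D: "real_distribution D"
    and F: "F = cdf D"
    and F_cont: "continuous_on UNIV F"
    and M: "prob_space M"
    and X_indep: "prob_space.indep_vars M (\<lambda>_. borel) X {1..}"
    and X_cdf: "\<And>i x. i \<ge> 1 \<Longrightarrow> cdf (distr M borel (X i)) x = F x powr record_alpha s i"
    and k: "k \<ge> 1"
    and n: "n \<ge> k"
  shows "measure M {\<omega> \<in> space M. record_time (\<lambda>i. X i \<omega>) k = enat n} =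
    real (stirling_level s (n - 1) (k - 1)) / (\<Prod>i=1..n. (1 + (real i - 1) ^ s))"
proof -
  interpret D: real_distribution D by (rule D)
  interpret prob_space M by (rule M)
  interpret level_sequence M X F s
    using X_indep X_cdf F_cont s D.cdf_nonneg D.cdf_lim_at_top_prob
    by unfold_locales (auto simp: F)
  obtain l where l: "k = Suc l" using k by (cases k) auto
  show ?thesis
  proof (cases "n = 1")
    \<comment> \<open>Here there is no past to take a maximum over: the first record time is always
      1, and the right-hand side is 1 because \<open>0 ^ s = 0\<close>.\<close>
    case True
    then have "k = 1" using k n by simp
    with True s show ?thesis
      by (simp add: stirling_level_def one_enat_def power_0_left prob_space)
  next
    case False
    then obtain m where m: "n = Suc m" "m \<ge> 1" using k n by (cases n) auto
    then show ?thesis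
      using prob_record_time[of m l] by (simp add: l joint_const_def)
  qed
qed

end
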